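(* Let $n\ge 3$, let $\theta_F\in(0,\pi/2)$, and let $\alpha,\alpha_1,\alpha_2>0$ be real numbers. Put $$\alpha^*:=\frac{2}{1+\sin\theta_F},\qquad \gamma^*:=\frac{1-\sin\theta_F}{1+\sin\theta_F}.$$ Then the following are equivalent: (i) for all linear subspaces $\mathcal{U},\mathcal{V}$ of $\mathbb{R}^n$ with dimensions $p=\dim\mathcal{U}$, $q=\dim\mathcal{V}$ in $\{1,\dots,n-1\}$ and with Friedrichs angle equal to $\theta_F$, in each of the three cases $p<q$, $p=q$ and $p>q$, the generalized alternating projections operator $$S=(1-\alpha)I+\alpha P_{\mathcal{U}}^{\alpha_2}P_{\mathcal{V}}^{\alpha_1}$$ is linearly convergent with any rate $\mu\in(\gamma^*,1)$; (ii) $\alpha=1$ and $\alpha_1=\alpha_2=\alpha^*$.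
   Context: $P_{\mathcal{C}}$ denotes the orthogonal projection onto $\mathcal{C}$, and $P_{\mathcal{C}}^{\alpha}:=(1-\alpha)I+\alpha P_{\mathcal{C}}$ is the relaxed projection with relaxation parameter $\alpha$. Principal angles: for subspaces $\mathcal{U},\mathcal{V}\subseteq\mathbb{R}^n$ and $m=\min(\dim\mathcal{U},\dim\mathcal{V})$, the principal angles $\theta_k\in[0,\pi/2]$, $k=1,\dots,m$, are defined recursively by $\cos\theta_k:=\max\langle u_k,v_k\rangle$ over $u_k\in\mathcal{U}$, $v_k\in\mathcal{V}$ with $\|u_k\|=\|v_k\|=1$ and $\langle u_k,v_i\rangle=\langle u_i,v_k\rangle=0$ for $i=1,\dots,k-1$ (where $u_i,v_i$ are maximizers from the earlier steps). They satisfy $0\le\theta_1\le\dots\le\theta_m\le\pi/2$. The Friedrichs angle is $\theta_F:=\theta_{s+1}$ with $s=\dim(\mathcal{U}\cap\mathcal{V})$, defined when $s<m$; it is the smallest non-zero principal angle. $A\in\mathbb{R}^{n\times n}$ is linearly convergent with rate $\mu\in[0,1)$ if there is a matrix $A^\infty$ and $M,N>0$ such that $\|A^k-A^\infty\|\le M\mu^k$ for all $k\in\mathbb{N}$, $k>N$ (operator norm). *)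

theory Defs
  imports "HOL-Analysis.Analysis"
begin

definition relaxed_projection :: "real \<Rightarrow> 'a::euclidean_space set \<Rightarrow> 'a \<Rightarrow> 'a" where
  "relaxed_projection \<alpha> C x = (1 - \<alpha>) *\<^sub>R x + \<alpha> *\<^sub>R closest_point C x"

text \<open>On a linear subspace, \<^const>\<open>closest_point\<close> is the orthogonal projection.\<close>

lemma closest_point_subspace_iff:
  fixes C :: "'a::euclidean_space set"
  assumes "subspace C"
  shows "closest_point C x = y \<longleftrightarrow> y \<in> C \<and> (\<forall>z\<in>C. orthogonal (x - y) z)"
proof -
  have cl: "closed C" "convex C" "C \<noteq> {}"
    using assms closed_subspace subspace_imp_convex subspace_0 by auto
  define p where "p = closest_point C x"
  have p: "p \<in> C"
    unfolding p_def using cl closest_point_in_set by blast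
  have orth: "orthogonal (x - p) z" if z: "z \<in> C" for z
  proof -
    have "p + z \<in> C" "p - z \<in> C"
      using p z assms subspace_add subspace_diff by blast+
    then have "(x - p) \<bullet> (p + z - p) \<le> 0" "(x - p) \<bullet> (p - z - p) \<le> 0"
      unfolding p_def using cl closest_point_dot by blast+
    then show ?thesis
      by (simp add: orthogonal_def)
  qed
  have "y = p" if "y \<in> C" "\<forall>z\<in>C. orthogonal (x - y) z" for y
  proof -
    have d: "y - p \<in> C"
      using that p assms subspace_diff by blast
    have "(x - p) \<bullet> (y - p) = 0" "(x - y) \<bullet> (y - p) = 0"
      using that orth d by (auto simp: orthogonal_def)
    then have "(y - p) \<bullet> (y - p) = 0"
      by (simp add: inner_diff_left)
    then show ?thesis by simp
  qed
  then show ?thesis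
    using p orth p_def by blast
qed

definition gap_operator ::
    "real \<Rightarrow> real \<Rightarrow> real \<Rightarrow> 'a::euclidean_space set \<Rightarrow> 'a set \<Rightarrow> 'a \<Rightarrow> 'a" where
  "gap_operator \<alpha> \<alpha>\<^sub>1 \<alpha>\<^sub>2 U V x =
     (1 - \<alpha>) *\<^sub>R x + \<alpha> *\<^sub>R relaxed_projection \<alpha>\<^sub>2 U (relaxed_projection \<alpha>\<^sub>1 V x)"

definition principal_feasible ::
    "'a::euclidean_space set \<Rightarrow> 'a set \<Rightarrow> (nat \<Rightarrow> 'a) \<Rightarrow> (nat \<Rightarrow> 'a) \<Rightarrow> nat \<Rightarrow> ('a \<times> 'a) set" where
  "principal_feasible U V u v k =
     {(x, y). x \<in> U \<and> y \<in> V \<and> norm x = 1 \<and> norm y = 1 \<and>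
        (\<forall>i\<in>{1..<k}. x \<bullet> v i = 0 \<and> u i \<bullet> y = 0)}"

definition principal_vectors ::
    "'a::euclidean_space set \<Rightarrow> 'a set \<Rightarrow> (nat \<Rightarrow> 'a) \<Rightarrow> (nat \<Rightarrow> 'a) \<Rightarrow> bool" where
  "principal_vectors U V u v \<longleftrightarrow>
     (\<forall>k\<in>{1..min (dim U) (dim V)}.
        (u k, v k) \<in> principal_feasible U V u v k \<and>
        (\<forall>(x, y)\<in>principal_feasible U V u v k. x \<bullet> y \<le> u k \<bullet> v k))"

text \<open>The maximizers are not unique, so the angles are given by a relation; their values do
  not depend on the maximizers chosen.\<close>

definition principal_angles ::
    "'a::euclidean_space set \<Rightarrow> 'a set \<Rightarrow> (nat \<Rightarrow> real) \<Rightarrow> bool" where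
  "principal_angles U V \<theta> \<longleftrightarrow>
     (\<exists>u v. principal_vectors U V u v \<and>
        (\<forall>k\<in>{1..min (dim U) (dim V)}. \<theta> k \<in> {0..pi/2} \<and> cos (\<theta> k) = u k \<bullet> v k))"

definition friedrichs_angle ::
    "'a::euclidean_space set \<Rightarrow> 'a set \<Rightarrow> real \<Rightarrow> bool" where
  "friedrichs_angle U V \<phi> \<longleftrightarrow>
     dim (U \<inter> V) < min (dim U) (dim V) \<and>
     (\<exists>\<theta>. principal_angles U V \<theta> \<and> \<phi> = \<theta> (dim (U \<inter> V) + 1))"

text \<open>On matrices, \<open>^\<close> is the componentwise power.\<close>

definition matrix_power :: "real^'n^'n \<Rightarrow> nat \<Rightarrow> real^'n^'n" where
  "matrix_power A k = ((**) A ^^ k) (mat 1)"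

definition linearly_convergent :: "real^'n^'n \<Rightarrow> real \<Rightarrow> bool" where
  "linearly_convergent A \<mu> \<longleftrightarrow>
     \<mu> \<in> {0..<1} \<and>
     (\<exists>L M N. M > 0 \<and> N > (0::nat) \<and>
        (\<forall>k>N. onorm ((*v) (matrix_power A k - L)) \<le> M * \<mu> ^ k))"

definition opt_relaxation :: "real \<Rightarrow> real" where
  "opt_relaxation \<theta> = 2 / (1 + sin \<theta>)"

definition opt_rate :: "real \<Rightarrow> real" where
  "opt_rate \<theta> = (1 - sin \<theta>) / (1 + sin \<theta>)"

end

theory Submission
  imports Defs
begin

text \<open>
  Write \<open>\<gamma>\<close> for the optimal rate. Sufficiency: with \<open>\<alpha>\<^sup>* = 1 + \<gamma>\<close> the operator
  \<open>T\<close> satisfies \<open>T\<^sup>2 - H T + \<gamma>\<^sup>2 = 0\<close>, where \<open>H\<close> is self-adjoint, commutes with both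
  projections and, by the definition of the Friedrichs angle, has norm at most \<open>2 \<gamma>\<close> on the part
  \<open>W\<close> of \<open>U + V\<close> orthogonal to \<open>U \<inter> V\<close>. A conserved energy of this three-term recursion then
  bounds \<open>\<parallel>T\<^sup>k\<parallel>\<close> on \<open>W\<close> by a multiple of \<open>k \<gamma>\<^sup>k\<close>, and \<open>T\<close> is \<open>1\<close> on \<open>U \<inter> V\<close> and
  \<open>\<gamma>\<^sup>2\<close> on the orthogonal complement of \<open>U + V\<close>.

  Necessity: take a line and a plane in a three-dimensional subspace, in both orders. The direction of
  the plane orthogonal to the line forces \<open>\<alpha> \<alpha>\<^sub>1, \<alpha> \<alpha>\<^sub>2 \<le> 1 + \<gamma>\<close>; on the remaining two
  dimensions the eigenvalues \<open>\<sigma>\<close>, \<open>\<tau>\<close> satisfy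
  \<open>(1 - \<sigma>) (1 - \<tau>) = \<alpha>\<^sup>2 \<alpha>\<^sub>1 \<alpha>\<^sub>2 sin\<^sup>2 \<theta>\<^sub>F \<le> (1 - \<gamma>)\<^sup>2\<close>, so
  both equal \<open>\<gamma>\<close> and all inequalities are equalities.
\<close>

section \<open>Orthogonal projections onto subspaces\<close>

lemma closest_point_subspaceI:
  fixes C :: "'a::euclidean_space set"
  assumes "subspace C" "y \<in> C" "\<And>z. z \<in> C \<Longrightarrow> (x - y) \<bullet> z = 0"
  shows "closest_point C x = y"
  using assms closest_point_subspace_iff[of C x y] by (auto simp: orthogonal_def)

lemma closest_point_subspace_in:
  fixes C :: "'a::euclidean_space set"
  assumes "subspace C"
  shows "closest_point C x \<in> C"
  using closest_point_subspace_iff[OF assms] by blast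

lemma closest_point_subspace_inner:
  fixes C :: "'a::euclidean_space set"
  assumes "subspace C" "z \<in> C"
  shows "closest_point C x \<bullet> z = x \<bullet> z"
  using closest_point_subspace_iff[OF assms(1), of x "closest_point C x"] assms(2)
  by (auto simp: orthogonal_def inner_diff_left)

lemma closest_point_subspace_eq_0:
  fixes C :: "'a::euclidean_space set"
  assumes "subspace C" "\<And>z. z \<in> C \<Longrightarrow> x \<bullet> z = 0"
  shows "closest_point C x = 0"
  by (rule closest_point_subspaceI) (use assms in \<open>auto simp: subspace_0\<close>)

lemma linear_closest_point_subspace:
  fixes C :: "'a::euclidean_space set"
  assumes "subspace C"
  shows "linear (closest_point C)"
proof (rule linearI)
  fix x y :: 'a and r :: real
  show "closest_point C (x + y) = closest_point C x + closest_point C y"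
    by (rule closest_point_subspaceI[OF assms])
      (auto simp: assms subspace_add closest_point_subspace_in closest_point_subspace_inner
        inner_diff_left inner_add_left)
  show "closest_point C (r *\<^sub>R x) = r *\<^sub>R closest_point C x"
    by (rule closest_point_subspaceI[OF assms])
      (auto simp: assms subspace_scale closest_point_subspace_in closest_point_subspace_inner
        inner_diff_left)
qed

lemma closest_point_subspace_adjoint:
  fixes C :: "'a::euclidean_space set"
  assumes "subspace C"
  shows "closest_point C x \<bullet> y = x \<bullet> closest_point C y"
  using closest_point_subspace_inner[OF assms closest_point_subspace_in[OF assms], of x y]
    closest_point_subspace_inner[OF assms closest_point_subspace_in[OF assms], of y x]
  by (simp add: inner_commute)

lemma linear_gap_operator:
  assumes "subspace U" "subspace V"
  shows "linear (gap_operator \<alpha> \<alpha>\<^sub>1 \<alpha>\<^sub>2 U V)"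
proof -
  interpret P: linear "closest_point U" by (rule linear_closest_point_subspace[OF assms(1)])
  interpret Q: linear "closest_point V" by (rule linear_closest_point_subspace[OF assms(2)])
  show ?thesis
    by (rule linearI)
      (simp_all add: gap_operator_def relaxed_projection_def P.add P.diff Q.add P.scale Q.scale
        algebra_simps)
qed

lemma matrix_mult_vec:
  fixes g :: "real^'n \<Rightarrow> real^'m"
  assumes "linear g"
  shows "matrix g *v x = g x"
  by (metis assms matrix_vector_mul(2))

lemma matrix_power_mult_vec:
  fixes g :: "real^'n \<Rightarrow> real^'n"
  assumes "linear g"
  shows "matrix_power (matrix g) k *v x = (g ^^ k) x"
proof (induction k arbitrary: x)
  case (Suc k)
  have "matrix_power (matrix g) (Suc k) *v x = matrix g *v (matrix_power (matrix g) k *v x)"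
    by (simp add: matrix_power_def matrix_vector_mul_assoc)
  then show ?case using Suc by (simp add: matrix_mult_vec[OF assms])
qed (simp add: matrix_power_def)

section \<open>The Friedrichs angle\<close>

text \<open>Fewer than \<open>dim (U \<inter> V)\<close> earlier maximizers leave a unit vector of
  \<open>U \<inter> V\<close> orthogonal to all of them. Paired with itself it is feasible with
  inner product 1, and equality in Cauchy-Schwarz forces the two maximizers to agree.\<close>

lemma principal_vectors_coincide:
  assumes U: "subspace U" and V: "subspace V"
    and uv: "principal_vectors U V u v"
    and k: "1 \<le> k" "k \<le> dim (U \<inter> V)"
  shows "u k = v k \<and> u k \<in> U \<inter> V"
  using k
proof (induction k rule: less_induct)
  case (less k)
  have sub: "subspace (U \<inter> V)" using U V by (rule subspace_inter)
  let ?B = "u ` {1..<k}"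
  have IH: "u i = v i \<and> u i \<in> U \<inter> V" if "i \<in> {1..<k}" for i
    using less.prems that by (intro less.IH) auto
  then have "?B \<subseteq> U \<inter> V" by blast
  then have sp: "span ?B \<subseteq> U \<inter> V" using sub by (rule span_minimal)
  have "dim ?B \<le> card ?B" by (intro dim_le_card') auto
  also have "\<dots> \<le> card {1..<k}" by (intro card_image_le) auto
  also have "\<dots> < dim (U \<inter> V)" using less.prems by simp
  finally have "span ?B \<noteq> U \<inter> V" using dim_span by (metis less_irrefl)
  with sp have "span ?B \<subset> span (U \<inter> V)" using sub by (simp add: span_eq_iff[THEN iffD2] psubset_eq)
  then obtain z where z: "z \<noteq> 0" "z \<in> span (U \<inter> V)" "\<And>y. y \<in> span ?B \<Longrightarrow> orthogonal z y"
    using orthogonal_to_subspace_exists_gen by metis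
  let ?z = "z /\<^sub>R norm z"
  have zm: "?z \<in> U \<inter> V" using z(2) sub span_eq_iff subspace_scale by metis
  have zo: "?z \<bullet> u i = 0" if "i \<in> {1..<k}" for i
    using z(3)[of "u i"] that by (auto simp: orthogonal_def span_base)
  have zf: "(?z, ?z) \<in> principal_feasible U V u v k"
    using zm zo IH z(1) by (simp add: principal_feasible_def inner_commute)
  have km: "k \<in> {1..min (dim U) (dim V)}"
    using less.prems dim_subset[of "U \<inter> V" U] dim_subset[of "U \<inter> V" V] by auto
  have ge: "1 \<le> u k \<bullet> v k"
  proof -
    have "?z \<bullet> ?z = 1" using z(1) by (simp add: dot_square_norm power2_eq_square)
    moreover have "?z \<bullet> ?z \<le> u k \<bullet> v k"
      using uv km zf unfolding principal_vectors_def by fast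
    ultimately show ?thesis by simp
  qed
  have F: "(u k, v k) \<in> principal_feasible U V u v k"
    using uv km unfolding principal_vectors_def by blast
  then have n: "u k \<in> U" "v k \<in> V" "norm (u k) = 1" "norm (v k) = 1"
    by (auto simp: principal_feasible_def)
  have "u k \<bullet> v k = 1" using ge norm_cauchy_schwarz[of "u k" "v k"] n by simp
  then have "u k = v k" using norm_cauchy_schwarz_eq[of "u k" "v k"] n by simp
  then show ?case using n by simp
qed

text \<open>At step \<open>dim (U \<inter> V) + 1\<close> all earlier maximizers lie in
  \<open>U \<inter> V\<close>, so the normalized \<open>x\<close> and \<open>y\<close> are feasible.
  No other property of the pair's Friedrichs angle enters sufficiency.\<close>

lemma friedrichs_angle_inner_le:
  assumes U: "subspace U" and V: "subspace V"
    and F: "friedrichs_angle U V \<phi>"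
    and x: "x \<in> U" "\<And>z. z \<in> U \<inter> V \<Longrightarrow> x \<bullet> z = 0"
    and y: "y \<in> V" "\<And>z. z \<in> U \<inter> V \<Longrightarrow> y \<bullet> z = 0"
  shows "x \<bullet> y \<le> cos \<phi> * norm x * norm y"
proof (cases "x = 0 \<or> y = 0")
  case False
  let ?s = "dim (U \<inter> V)"
  obtain \<theta> u v where s: "?s < min (dim U) (dim V)" and uv: "principal_vectors U V u v"
    and th: "\<And>k. k \<in> {1..min (dim U) (dim V)} \<Longrightarrow> cos (\<theta> k) = u k \<bullet> v k"
    and phi: "\<phi> = \<theta> (?s + 1)"
    using F unfolding friedrichs_angle_def principal_angles_def by blast
  have co: "u i = v i" "u i \<in> U \<inter> V" if "i \<in> {1..<?s + 1}" for i
    using principal_vectors_coincide[OF U V uv, of i] that by auto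
  have sm: "?s + 1 \<in> {1..min (dim U) (dim V)}" using s by auto
  have "(x /\<^sub>R norm x, y /\<^sub>R norm y) \<in> principal_feasible U V u v (?s + 1)"
    using False x y co subspace_scale[OF U] subspace_scale[OF V]
    by (auto simp: principal_feasible_def inner_commute) (metis inner_commute)+
  then have "(x /\<^sub>R norm x) \<bullet> (y /\<^sub>R norm y) \<le> u (?s + 1) \<bullet> v (?s + 1)"
    using uv sm unfolding principal_vectors_def by fast
  also have "\<dots> = cos \<phi>" using th[OF sm] phi by simp
  finally show ?thesis using False by (simp add: field_simps)
qed auto

text \<open>Exchanging the two families of maximizers exchanges the subspaces. Necessity applies the
  hypothesis to one pair in both orders.\<close>

lemma friedrichs_angle_commute:
  "friedrichs_angle U V \<phi> \<longleftrightarrow> friedrichs_angle V U \<phi>"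
proof -
  have pf: "(x, y) \<in> principal_feasible U V u v k \<longleftrightarrow> (y, x) \<in> principal_feasible V U v u k"
    for x y :: 'a and U V u v k
    by (auto simp: principal_feasible_def inner_commute)
  have pv: "principal_vectors V U v u" if "principal_vectors U V u v" for U V :: "'a set" and u v
    unfolding principal_vectors_def
  proof (intro ballI conjI)
    fix k assume "k \<in> {1..min (dim V) (dim U)}"
    then have "k \<in> {1..min (dim U) (dim V)}" by simp
    then have *: "(u k, v k) \<in> principal_feasible U V u v k"
      "\<And>x y. (x, y) \<in> principal_feasible U V u v k \<Longrightarrow> x \<bullet> y \<le> u k \<bullet> v k"
      using that unfolding principal_vectors_def by blast+
    show "(v k, u k) \<in> principal_feasible V U v u k" using *(1) pf by blast
    show "case z of (x, y) \<Rightarrow> x \<bullet> y \<le> v k \<bullet> u k" if "z \<in> principal_feasible V U v u k" for z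
      using that *(2)[of "snd z" "fst z"] pf[of "fst z" "snd z" V U v u k]
      by (cases z) (simp add: inner_commute)
  qed
  have pa: "principal_angles V U \<theta>" if angles: "principal_angles U V \<theta>" for U V :: "'a set" and \<theta>
  proof -
    obtain u v where "principal_vectors U V u v"
      and *: "\<And>k. k \<in> {1..min (dim U) (dim V)} \<Longrightarrow> \<theta> k \<in> {0..pi/2} \<and> cos (\<theta> k) = u k \<bullet> v k"
      using angles unfolding principal_angles_def by blast
    then have "principal_vectors V U v u" using pv by blast
    moreover have "\<forall>k\<in>{1..min (dim V) (dim U)}. \<theta> k \<in> {0..pi/2} \<and> cos (\<theta> k) = v k \<bullet> u k"
      using * by (simp add: inner_commute)
    ultimately show ?thesis unfolding principal_angles_def by blast
  qed
  have "principal_angles U V \<theta> \<longleftrightarrow> principal_angles V U \<theta>" for \<theta>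
    using pa by blast
  then show ?thesis
    by (simp add: friedrichs_angle_def Int_commute[of V U] min.commute[of "dim V"])
qed

section \<open>Sufficiency\<close>

text \<open>For a scalar \<open>H\<close> in [-1, 1] the characteristic roots lie on the unit circle
  and coincide at the endpoints, which accounts for the linear growth.\<close>

lemma three_term_growth:
  fixes H :: "'a::euclidean_space \<Rightarrow> 'a" and x :: "nat \<Rightarrow> 'a"
  assumes sa: "\<And>a b. H a \<bullet> b = a \<bullet> H b"
    and H: "\<And>k. norm (H (x k)) \<le> norm (x k)"
    and rec: "\<And>k. x (Suc (Suc k)) = 2 *\<^sub>R H (x (Suc k)) - x k"
  shows "norm (x k) \<le> norm (x 0) + real k * (norm (x 0) + norm (x 1))"
proof -
  define E where "E k = (norm (x (Suc k)))\<^sup>2 + (norm (x k))\<^sup>2 - 2 * (H (x (Suc k)) \<bullet> x k)" for k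
  have "E (Suc k) = E k" for k
  proof -
    let ?a = "x (Suc k)" let ?b = "x k"
    have "H (2 *\<^sub>R H ?a - ?b) \<bullet> ?a = 2 * (H ?a \<bullet> H ?a) - H ?a \<bullet> ?b"
      by (simp add: sa[of "2 *\<^sub>R H ?a - ?b" ?a] inner_diff_left inner_commute[of ?b "H ?a"])
    moreover have "(norm (2 *\<^sub>R H ?a - ?b))\<^sup>2 = 4 * (H ?a \<bullet> H ?a) - 4 * (H ?a \<bullet> ?b) + (norm ?b)\<^sup>2"
      by (simp add: power2_norm_eq_inner inner_diff inner_commute[of ?b "H ?a"])
    ultimately show ?thesis by (simp add: E_def rec)
  qed
  then have E0: "E k = E 0" for k by (induction k) auto
  have "(norm (x (Suc k) - H (x k)))\<^sup>2 \<le> (norm (x 0) + norm (x 1))\<^sup>2" for k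
  proof -
    \<comment> \<open>Completing the square in \<open>E k\<close>; the remainder is nonnegative
      because \<open>H\<close> does not expand \<open>x k\<close>.\<close>
    have "(norm (x (Suc k) - H (x k)))\<^sup>2 = E k - (norm (x k))\<^sup>2 + (norm (H (x k)))\<^sup>2"
      using inner_commute[of "H (x k)" "x (Suc k)"]
      by (simp add: E_def power2_norm_eq_inner inner_diff sa[of "x (Suc k)"])
    also have "\<dots> \<le> E k" using H[of k] by (simp add: power_mono)
    also have "\<dots> = (norm (x 1))\<^sup>2 + (norm (x 0))\<^sup>2 - 2 * (x 1 \<bullet> H (x 0))"
      using E0[of k] by (simp add: E_def sa[of "x 1"] flip: One_nat_def)
    also have "- (x 1 \<bullet> H (x 0)) \<le> norm (x 1) * norm (x 0)"
      using Cauchy_Schwarz_ineq2[of "x 1" "H (x 0)"] H[of 0]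
        mult_left_mono[OF H[of 0], of "norm (x 1)"] by simp
    then have "(norm (x 1))\<^sup>2 + (norm (x 0))\<^sup>2 - 2 * (x 1 \<bullet> H (x 0)) \<le> (norm (x 0) + norm (x 1))\<^sup>2"
      by (simp add: power2_sum mult.commute[of "norm (x 0)" "norm (x (Suc 0))"])
    finally show ?thesis .
  qed
  then have step: "norm (x (Suc k) - H (x k)) \<le> norm (x 0) + norm (x 1)" for k
    by (rule power2_le_imp_le) simp
  show ?thesis
  proof (induction k)
    case (Suc k)
    have "norm (x (Suc k)) \<le> norm (x (Suc k) - H (x k)) + norm (H (x k))"
      by (metis diff_add_cancel norm_triangle_ineq)
    also have "\<dots> \<le> norm (x 0) + norm (x 1) + norm (x k)"
      using step H by (rule add_mono)
    finally show ?case using Suc by (simp add: algebra_simps)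
  qed simp
qed

section \<open>Geometry of the two projections\<close>

text \<open>\<open>c\<close> plays the role of the cosine of the Friedrichs angle.\<close>

locale friedrichs_pair =
  fixes U V :: "'a::euclidean_space set" and c :: real
  assumes U: "subspace U" and V: "subspace V"
    and inner_le: "\<And>x y. x \<in> U \<Longrightarrow> (\<And>z. z \<in> U \<inter> V \<Longrightarrow> x \<bullet> z = 0) \<Longrightarrow>
      y \<in> V \<Longrightarrow> (\<And>z. z \<in> U \<inter> V \<Longrightarrow> y \<bullet> z = 0) \<Longrightarrow> x \<bullet> y \<le> c * norm x * norm y"
    and c: "0 < c" "c < 1"
begin

abbreviation P where "P \<equiv> closest_point U"
abbreviation Q where "Q \<equiv> closest_point V"
abbreviation "U' \<equiv> {x \<in> U. \<forall>z\<in>U \<inter> V. x \<bullet> z = 0}"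
abbreviation "V' \<equiv> {x \<in> V. \<forall>z\<in>U \<inter> V. x \<bullet> z = 0}"
definition W where "W = {x + y |x y. x \<in> U' \<and> y \<in> V'}"
text \<open>The square of \<open>N\<close> is I - P - Q + PQ + QP, which commutes with both
  projections. In a plane that the subspaces meet in two lines at angle \<theta> it is the scalar
  cos^2 \<theta>.\<close>

definition N where "N x = x - P x - Q x"

sublocale P: linear P by (rule linear_closest_point_subspace[OF U])
sublocale Q: linear Q by (rule linear_closest_point_subspace[OF V])

lemmas PQ_in [simp] = closest_point_subspace_in[OF U] closest_point_subspace_in[OF V]

lemma PQ_idem [simp]: "P (P x) = P x" "Q (Q x) = Q x"
  by (auto intro: closest_point_self)

lemma P_inner: "P x \<bullet> P y = P x \<bullet> y"
  using closest_point_subspace_inner[OF U PQ_in(1), of y x] by (simp add: inner_commute)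

lemma Q_inner: "Q x \<bullet> Q y = Q x \<bullet> y"
  using closest_point_subspace_inner[OF V PQ_in(2), of y x] by (simp add: inner_commute)

lemma subspace_U': "subspace U'" and subspace_V': "subspace V'"
  using U V by (auto simp: subspace_def inner_add_left)

lemma subspace_W: "subspace W"
  unfolding W_def by (rule subspace_sums[OF subspace_U' subspace_V'])

lemma W_orth: "x \<in> W \<Longrightarrow> z \<in> U \<inter> V \<Longrightarrow> x \<bullet> z = 0"
  by (auto simp: W_def inner_add_left)

lemma U'_W: "x \<in> W" if "x \<in> U'"
  using that subspace_0[OF subspace_V'] add_0_right[of x, symmetric] unfolding W_def by blast

lemma V'_W: "x \<in> W" if "x \<in> V'"
  using that subspace_0[OF subspace_U'] add_0_left[of x, symmetric] unfolding W_def by blast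

lemma P_orth: "P x \<in> U'" if "\<And>z. z \<in> U \<inter> V \<Longrightarrow> x \<bullet> z = 0"
  by (simp add: closest_point_subspace_inner U that)

lemma Q_orth: "Q x \<in> V'" if "\<And>z. z \<in> U \<inter> V \<Longrightarrow> x \<bullet> z = 0"
  by (simp add: closest_point_subspace_inner V that)

lemma P_W: "x \<in> W \<Longrightarrow> P x \<in> W" and Q_W: "x \<in> W \<Longrightarrow> Q x \<in> W"
  by (rule U'_W[OF P_orth], erule (1) W_orth) (rule V'_W[OF Q_orth], erule (1) W_orth)

lemma N_W: "x \<in> W \<Longrightarrow> N x \<in> W"
  unfolding N_def by (intro subspace_diff[OF subspace_W] P_W Q_W)

lemma N_adjoint: "N x \<bullet> y = x \<bullet> N y"
  using closest_point_subspace_adjoint[OF U, of x y] closest_point_subspace_adjoint[OF V, of x y]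
  by (simp add: N_def inner_diff)

lemma proj_U'_le: "norm (Q x) \<le> c * norm x" if "x \<in> U'"
proof (cases "Q x = 0")
  case False
  have q: "Q x \<in> V'" using that Q_orth by blast
  have "norm (Q x) * norm (Q x) = x \<bullet> Q x"
    using Q_inner[of x x] by (simp add: inner_commute norm_eq_square flip: power2_eq_square power2_norm_eq_inner)
  also have "\<dots> \<le> c * norm x * norm (Q x)"
    using inner_le[of x "Q x"] that q by auto
  finally show ?thesis using False by simp
qed (use c in simp)

lemma proj_V'_le: "norm (P x) \<le> c * norm x" if "x \<in> V'"
proof (cases "P x = 0")
  case False
  have q: "P x \<in> U'" using that P_orth by blast
  have "norm (P x) * norm (P x) = P x \<bullet> x"
    using P_inner[of x x] by (simp add: inner_commute norm_eq_square flip: power2_eq_square power2_norm_eq_inner)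
  also have "\<dots> \<le> c * norm (P x) * norm x"
    using inner_le[of "P x" x] that q by auto
  finally show ?thesis using False by simp
qed (use c in simp)

lemma norm_P_decomp: "(norm x)\<^sup>2 = (norm (P x))\<^sup>2 + (norm (x - P x))\<^sup>2"
  using P_inner[of x x] by (simp add: power2_norm_eq_inner inner_diff inner_commute[of x "P x"])

lemma norm_Q_decomp: "(norm x)\<^sup>2 = (norm (Q x))\<^sup>2 + (norm (x - Q x))\<^sup>2"
  using Q_inner[of x x] by (simp add: power2_norm_eq_inner inner_diff inner_commute[of x "Q x"])

text \<open>The Friedrichs angle of the orthogonal complements is the same: a vector of \<open>W\<close> that is
  orthogonal to \<open>U\<close> has the form \<open>v - P v\<close> with \<open>v \<in> V'\<close>.\<close>

lemma complement_le: "norm (q - Q q) \<le> c * norm q" if v: "v \<in> V'" and q: "q = v - P v"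
proof (cases "q = 0")
  case False
  have "(norm v)\<^sup>2 = (norm (P v))\<^sup>2 + (norm q)\<^sup>2" using norm_P_decomp[of v] q by simp
  moreover have "(norm (P v))\<^sup>2 \<le> (c * norm v)\<^sup>2" by (intro power_mono proj_V'_le v) simp
  ultimately have a: "(1 - c\<^sup>2) * (norm v)\<^sup>2 \<le> (norm q)\<^sup>2" by (simp add: power_mult_distrib algebra_simps)
  \<comment> \<open>Testing \<open>q\<close> against \<open>v\<close> bounds \<open>Q q\<close> from
    below by Cauchy-Schwarz; with \<open>a\<close> this becomes \<open>(1 - c\<^sup>2) * (norm
    q)\<^sup>2 \<le> (norm (Q q))\<^sup>2\<close>, and Pythagoras turns it into the bound on
    \<open>q - Q q\<close>.\<close>
  have "(norm q)\<^sup>2 = q \<bullet> v"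
    using P_inner[of v v] by (simp add: q power2_norm_eq_inner inner_diff inner_commute)
  also have "\<dots> = Q q \<bullet> v" using closest_point_subspace_inner[OF V, of v q] v by simp
  also have "\<dots> \<le> norm (Q q) * norm v" by (rule norm_cauchy_schwarz)
  finally have "((norm q)\<^sup>2)\<^sup>2 \<le> (norm (Q q) * norm v)\<^sup>2" by (intro power_mono) auto
  then have "(1 - c\<^sup>2) * ((norm q)\<^sup>2)\<^sup>2 \<le> (1 - c\<^sup>2) * (norm (Q q) * norm v)\<^sup>2"
    using c by (intro mult_left_mono) (auto simp: power_le_one)
  also have "\<dots> = (norm (Q q))\<^sup>2 * ((1 - c\<^sup>2) * (norm v)\<^sup>2)"
    by (simp add: power_mult_distrib)
  also have "\<dots> \<le> (norm (Q q))\<^sup>2 * (norm q)\<^sup>2" using a by (intro mult_left_mono) auto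
  finally have "(1 - c\<^sup>2) * (norm q)\<^sup>2 * (norm q)\<^sup>2 \<le> (norm (Q q))\<^sup>2 * (norm q)\<^sup>2"
    by (simp add: power2_eq_square mult.assoc)
  then have "(1 - c\<^sup>2) * (norm q)\<^sup>2 \<le> (norm (Q q))\<^sup>2" using False by simp
  then have "(norm (q - Q q))\<^sup>2 \<le> (c * norm q)\<^sup>2"
    using norm_Q_decomp[of q] by (simp add: power_mult_distrib algebra_simps)
  then show ?thesis by (rule power2_le_imp_le) (use c in simp)
qed (simp add: Q.zero)

text \<open>With \<open>q = w - P w\<close>, \<open>N w\<close> is \<open>q - Q q\<close>,
  orthogonal to \<open>V\<close>, minus \<open>Q (P w)\<close>, which lies in \<open>V\<close>. The
  parts are at most \<open>c\<close> times \<open>norm q\<close> and \<open>norm (P w)\<close>, and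
  Pythagoras applies on both sides.\<close>

lemma N_le: "(norm (N w))\<^sup>2 \<le> c\<^sup>2 * (norm w)\<^sup>2" if w: "w \<in> W"
proof -
  obtain u v where uv: "u \<in> U'" "v \<in> V'" "w = u + v" using w W_def by blast
  let ?q = "w - P w"
  \<comment> \<open>\<open>P\<close> fixes \<open>u\<close>, so \<open>w - P w\<close> comes from
    the \<open>V'\<close> summand alone, as \<open>complement_le\<close> requires.\<close>
  have "P u = u" using uv by (simp add: closest_point_self)
  then have q: "?q = v - P v" using uv by (simp add: P.add)
  have Pw: "P w \<in> U'" using P_orth W_orth[OF w] by blast
  have Nw: "N w = (?q - Q ?q) - Q (P w)" by (simp add: N_def Q.diff)
  have orth: "(?q - Q ?q) \<bullet> Q (P w) = 0"
    using closest_point_subspace_inner[OF V PQ_in(2), of ?q] by (simp add: inner_diff_left)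
  have "(norm (N w))\<^sup>2 = (norm (?q - Q ?q))\<^sup>2 + (norm (Q (P w)))\<^sup>2"
    unfolding Nw using orth by (simp add: power2_norm_eq_inner inner_diff inner_commute)
  also have "\<dots> \<le> (c * norm ?q)\<^sup>2 + (c * norm (P w))\<^sup>2"
    using complement_le[OF uv(2) q] proj_U'_le[OF Pw] by (intro add_mono power_mono) auto
  also have "\<dots> = c\<^sup>2 * (norm w)\<^sup>2"
    using norm_P_decomp[of w] by (simp add: power_mult_distrib algebra_simps)
  finally show ?thesis .
qed

end

section \<open>The operator at the optimal parameters\<close>

text \<open>\<open>g\<close> is the optimal rate and \<open>a\<close> the optimal relaxation. Where
  the square of \<open>N\<close> equals \<open>c\<^sup>2\<close>, condition \<open>ac\<close> gives
  \<open>H\<close> the value \<open>2 * g\<close>, so the quadratic of the three-term recursion has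
  the double root \<open>g\<close>.\<close>

locale optimal_relaxation = friedrichs_pair +
  fixes g a :: real
  assumes g: "0 < g" "g < 1" and a: "a = 1 + g" and ac: "a\<^sup>2 * c\<^sup>2 = 4 * g"
begin

definition H where "H x = a\<^sup>2 *\<^sub>R N (N x) - (2 * g) *\<^sub>R x"
abbreviation T where "T \<equiv> gap_operator 1 a a U V"

lemma T_eq: "T x = (1 - a) *\<^sub>R ((1 - a) *\<^sub>R x + a *\<^sub>R Q x) + a *\<^sub>R P ((1 - a) *\<^sub>R x + a *\<^sub>R Q x)"
  by (simp add: gap_operator_def relaxed_projection_def)

sublocale T: linear T by (rule linear_gap_operator[OF U V])

lemma linear_N: "linear N"
  by (rule linearI) (simp_all add: N_def P.add Q.add P.scale Q.scale algebra_simps)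

lemma linear_H: "linear H"
  using linear_add[OF linear_N] linear_scale[OF linear_N]
  by (intro linearI) (simp_all add: H_def algebra_simps)

text \<open>\<open>T\<close> is invertible with \<open>g\<^sup>2 T\<^sup>-\<^sup>1 = (a Q - 1) (a P - 1)\<close>, and \<open>T + g\<^sup>2 T\<^sup>-\<^sup>1\<close> is the
  self-adjoint operator \<open>H\<close>.\<close>

lemma T_three_term: "T (T x) = H (T x) - (g * g) *\<^sub>R x"
proof -
  define y where "y = T x"
  define B where "B = a *\<^sub>R P y - y"
  \<comment> \<open>Since \<open>P\<close> is idempotent and \<open>a - 1 = g\<close>,
    \<open>a P - 1\<close> inverts the relaxed projection onto \<open>U\<close> up to the factor
    \<open>g\<close>; fact \<open>1\<close> repeats this for \<open>Q\<close>.\<close>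
  have B: "B = g *\<^sub>R ((1 - a) *\<^sub>R x + a *\<^sub>R Q x)"
    unfolding B_def y_def T_eq unfolding a
    by (simp add: P.add P.diff P.scale algebra_simps)
  have 1: "a *\<^sub>R Q B - B = (g * g) *\<^sub>R x"
    unfolding B unfolding a by (simp add: Q.add Q.diff Q.scale algebra_simps)
  have dbl: "(g * 2) *\<^sub>R v = g *\<^sub>R v + g *\<^sub>R v" for v :: 'a
    by (simp flip: scaleR_add_left)
  \<comment> \<open>\<open>P\<close> and \<open>Q\<close> receive the total coefficient
    \<open>- a * (1 + g)\<close>, that is minus \<open>a\<^sup>2\<close>, so they combine with PQ +
    QP into the square of \<open>N\<close>.\<close>
  have 2: "T y + (a *\<^sub>R Q B - B) = H y"
    unfolding B_def T_eq H_def N_def unfolding a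
    by (simp add: P.add P.diff P.scale Q.add Q.diff Q.scale
        power2_eq_square dbl algebra_simps)
  show ?thesis using 1 2 by (simp add: y_def eq_diff_eq)
qed

lemma T_W: "x \<in> W \<Longrightarrow> T x \<in> W"
  unfolding T_eq
  by (intro subspace_add[OF subspace_W] subspace_scale[OF subspace_W] P_W Q_W)

text \<open>In the expanded square, \<open>N_le\<close> applied to \<open>N w\<close> and
  \<open>ac\<close> bound the first term by \<open>4 * g * a\<^sup>2 * (norm (N w))\<^sup>2\<close>,
  which cancels the mixed term.\<close>

lemma norm_H_le: "norm (H w) \<le> 2 * g * norm w" if w: "w \<in> W"
proof -
  have "(norm (H w))\<^sup>2 = (a\<^sup>2)\<^sup>2 * (norm (N (N w)))\<^sup>2 - 4 * g * a\<^sup>2 * (norm (N w))\<^sup>2 + 4 * g\<^sup>2 * (norm w)\<^sup>2"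
    using N_adjoint[of "N w" w] N_adjoint[of w "N w"]
    unfolding H_def power2_norm_eq_inner
    by (simp add: inner_diff inner_commute[of w "N (N w)"]
        power2_eq_square algebra_simps)
  also have "(a\<^sup>2)\<^sup>2 * (norm (N (N w)))\<^sup>2 \<le> (a\<^sup>2)\<^sup>2 * (c\<^sup>2 * (norm (N w))\<^sup>2)"
    by (intro mult_left_mono N_le N_W w) simp
  also have "\<dots> = a\<^sup>2 * (a\<^sup>2 * c\<^sup>2) * (norm (N w))\<^sup>2"
    by (simp add: power2_eq_square)
  also have "\<dots> = 4 * g * a\<^sup>2 * (norm (N w))\<^sup>2" unfolding ac by simp
  finally have "(norm (H w))\<^sup>2 \<le> (2 * g * norm w)\<^sup>2" by (simp add: power_mult_distrib)
  then show ?thesis by (rule power2_le_imp_le) (use g in simp)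
qed

lemma T_growth_W: "norm ((T ^^ k) w) \<le> g ^ k * (norm w + real k * (norm w + norm (T w) / g))"
  if w: "w \<in> W"
proof -
  \<comment> \<open>Division by \<open>g ^ k\<close> turns the coefficient \<open>g * g\<close> of
    the recursion into 1, as \<open>three_term_growth\<close> requires; \<open>H'\<close> is
    nonexpansive on \<open>W\<close> by \<open>norm_H_le\<close>.\<close>
  define x where "x k = (T ^^ k) w /\<^sub>R g ^ k" for k
  define H' where "H' y = H y /\<^sub>R (2 * g)" for y
  have "norm (x k) \<le> norm (x 0) + real k * (norm (x 0) + norm (x 1))"
  proof (rule three_term_growth[of H'])
    show "H' y \<bullet> z = y \<bullet> H' z" for y z
      using N_adjoint[of "N y" z] N_adjoint[of y "N z"]
      by (simp add: H'_def H_def inner_diff)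
    have "(T ^^ k) w \<in> W" for k by (induction k) (auto intro: w T_W)
    then have "x k \<in> W" for k unfolding x_def by (intro subspace_scale[OF subspace_W])
    then show "norm (H' (x k)) \<le> norm (x k)" for k
      using norm_H_le[of "x k"] g by (simp add: H'_def field_simps)
    show "x (Suc (Suc k)) = 2 *\<^sub>R H' (x (Suc k)) - x k" for k
      using g
      by (simp add: x_def H'_def T_three_term linear_scale[OF linear_H] scaleR_diff_right field_simps)
  qed
  then have "g ^ k * norm (x k) \<le> g ^ k * (norm (x 0) + real k * (norm (x 0) + norm (x 1)))"
    using g by (intro mult_left_mono) auto
  moreover have "g ^ k * norm (x k) = norm ((T ^^ k) w)" using g by (simp add: x_def)
  moreover have "norm (x 0) = norm w" "norm (x 1) = norm (T w) / g"
    using g by (simp_all add: x_def divide_inverse mult.commute)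
  ultimately show ?thesis by simp
qed

lemma T_orth: "T j = (g * g) *\<^sub>R j" if "\<And>z. z \<in> U \<Longrightarrow> j \<bullet> z = 0" "\<And>z. z \<in> V \<Longrightarrow> j \<bullet> z = 0"
  using closest_point_subspace_eq_0[OF U, of j] closest_point_subspace_eq_0[OF V, of j] that
  by (simp add: T_eq P.scale) (simp add: a)

lemma T_Int: "T i = i" if "i \<in> U \<inter> V"
  using that by (simp add: T_eq closest_point_self flip: scaleR_add_left)

lemma T_decomp:
  obtains i w j where "x = i + w + j" "i = closest_point (U \<inter> V) x" "w \<in> W"
    "T i = i" "T j = (g * g) *\<^sub>R j" "norm w \<le> norm x" "norm j \<le> norm x"
proof -
  define i where "i = closest_point (U \<inter> V) x"
  define w where "w = closest_point W x"
  define j where "j = x - i - w"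
  have UV: "subspace (U \<inter> V)" using U V by (rule subspace_inter)
  have i: "i \<in> U \<inter> V" unfolding i_def by (rule closest_point_subspace_in[OF UV])
  have w: "w \<in> W" unfolding w_def by (rule closest_point_subspace_in[OF subspace_W])
  have jW: "j \<bullet> z = 0" if "z \<in> W" for z
    using closest_point_subspace_inner[OF subspace_W that, of x] W_orth[OF that i]
    by (simp add: j_def w_def inner_diff_left inner_commute[of i])
  have jI: "j \<bullet> z = 0" if "z \<in> U \<inter> V" for z
    using closest_point_subspace_inner[OF UV that, of x] W_orth[OF w that]
    by (simp add: j_def i_def inner_diff_left)
  \<comment> \<open>\<open>P j\<close> lies in \<open>U'\<close>, hence in \<open>W\<close>, to
    which \<open>j\<close> is orthogonal; but \<open>j \<bullet> P j\<close> is the squared norm of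
    \<open>P j\<close>. So \<open>j\<close> is orthogonal to all of \<open>U\<close>, and likewise
    to \<open>V\<close>.\<close>
  have "j \<bullet> P j = 0" using jW[OF U'_W[OF P_orth]] jI by blast
  then have Pj: "P j = 0" using P_inner[of j j] by (simp add: inner_commute)
  have "j \<bullet> Q j = 0" using jW[OF V'_W[OF Q_orth]] jI by blast
  then have Qj: "Q j = 0" using Q_inner[of j j] by (simp add: inner_commute)
  have jU: "j \<bullet> z = 0" if "z \<in> U" for z
    using closest_point_subspace_inner[OF U that, of j] Pj by simp
  have jV: "j \<bullet> z = 0" if "z \<in> V" for z
    using closest_point_subspace_inner[OF V that, of j] Qj by simp
  have x: "x = i + w + j" by (simp add: j_def)
  have "(norm x)\<^sup>2 = (norm i)\<^sup>2 + (norm w)\<^sup>2 + (norm j)\<^sup>2"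
    using W_orth[OF w i] jW[OF w] jI[OF i]
    by (simp add: x power2_norm_eq_inner inner_add inner_commute)
  then have "(norm w)\<^sup>2 \<le> (norm x)\<^sup>2" "(norm j)\<^sup>2 \<le> (norm x)\<^sup>2" by simp_all
  then have "norm w \<le> norm x" "norm j \<le> norm x"
    by (auto intro: power2_le_imp_le)
  with that x i_def w T_Int[OF i] T_orth[OF jU jV] show ?thesis by blast
qed

lemma T_power_bound:
  obtains C where "C > 0"
    "\<And>k x. norm ((T ^^ k) x - closest_point (U \<inter> V) x) \<le> g ^ k * (2 + real k * C) * norm x"
proof -
  obtain K where K: "K > 0" "\<And>x. norm (T x) \<le> K * norm x"
    using linear_bounded_pos[OF T.linear_axioms] by blast
  \<comment> \<open>This bounds \<open>norm w + norm (T w) / g\<close> by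
    \<open>?C * norm x\<close>. The 2 in the claim collects one \<open>norm x\<close> from
    \<open>w\<close> and one from \<open>j\<close>.\<close>
  let ?C = "1 + K / g"
  have "norm ((T ^^ k) x - closest_point (U \<inter> V) x) \<le> g ^ k * (2 + real k * ?C) * norm x" for k x
  proof -
    obtain i w j where x: "x = i + w + j" and i: "i = closest_point (U \<inter> V) x"
      and w: "w \<in> W" and T: "T i = i" "T j = (g * g) *\<^sub>R j"
      and le: "norm w \<le> norm x" "norm j \<le> norm x" by (rule T_decomp)
    have "(T ^^ k) j = (g ^ k * g ^ k) *\<^sub>R j"
      by (induction k) (simp_all add: T T.scale)
    moreover have "(T ^^ k) i = i"
      by (induction k) (simp_all add: T)
    moreover have "(T ^^ k) (i + w + j) = (T ^^ k) i + (T ^^ k) w + (T ^^ k) j"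
      by (induction k) (simp_all add: T.add)
    ultimately have "norm ((T ^^ k) x - i) = norm ((T ^^ k) w + (g ^ k * g ^ k) *\<^sub>R j)"
      unfolding x by simp
    also have "\<dots> \<le> norm ((T ^^ k) w) + norm ((g ^ k * g ^ k) *\<^sub>R j)" by (rule norm_triangle_ineq)
    also have "norm ((g ^ k * g ^ k) *\<^sub>R j) = g ^ k * (g ^ k * norm j)" using g by simp
    also have "g ^ k * (g ^ k * norm j) \<le> g ^ k * norm x"
      using g le(2) mult_mono[of "g ^ k" 1 "norm j" "norm x"] by (simp add: power_le_one)
    also have "norm ((T ^^ k) w) \<le> g ^ k * (norm w + real k * (norm w + norm (T w) / g))"
      by (rule T_growth_W[OF w])
    also have "\<dots> \<le> g ^ k * (norm x + real k * (norm x + K * norm x / g))"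
    proof -
      have "norm (T w) \<le> K * norm x"
        using K(2)[of w] mult_left_mono[OF le(1) less_imp_le[OF K(1)]] by (rule order_trans)
      then have "norm (T w) / g \<le> K * norm x / g" using g by (intro divide_right_mono) auto
      then show ?thesis using le(1) g by (intro mult_left_mono add_mono) auto
    qed
    finally show ?thesis by (simp add: i[symmetric] algebra_simps)
  qed
  moreover have "?C > 0" using K g by (simp add: add_pos_pos)
  ultimately show ?thesis using that by blast
qed

end

section \<open>Linear convergence in terms of iterates\<close>

lemma linearly_convergentI:
  fixes S L :: "real^'n \<Rightarrow> real^'n"
  assumes "linear S" "linear L" "\<mu> \<in> {0..<1}" "M > 0"
    and le: "\<And>k x. norm ((S ^^ k) x - L x) \<le> M * \<mu> ^ k * norm x"
  shows "linearly_convergent (matrix S) \<mu>"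
proof -
  have "onorm ((*v) (matrix_power (matrix S) k - matrix L)) \<le> M * \<mu> ^ k" for k
  proof (rule onorm_bound)
    show "0 \<le> M * \<mu> ^ k" using assms(3,4) by simp
    show "norm ((matrix_power (matrix S) k - matrix L) *v x) \<le> M * \<mu> ^ k * norm x" for x
      using le[of k x]
      by (simp add: matrix_vector_mult_diff_rdistrib matrix_power_mult_vec[OF assms(1)]
          matrix_mult_vec[OF assms(2)])
  qed
  \<comment> \<open>The bound holds for every \<open>k\<close>; the threshold 1 is chosen because it
    has to be positive.\<close>
  then have "\<forall>k>1. onorm ((*v) (matrix_power (matrix S) k - matrix L)) \<le> M * \<mu> ^ k" by blast
  then show ?thesis
    unfolding linearly_convergent_def using assms(3,4) zero_less_one by blast
qed

text \<open>Consecutive differences eliminate the unknown limit matrix \<open>L\<close>.\<close>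

lemma linearly_convergentD:
  fixes S :: "real^'n \<Rightarrow> real^'n"
  assumes "linear S" "linearly_convergent (matrix S) \<mu>"
  obtains C N where "\<And>k. k > N \<Longrightarrow> norm ((S ^^ Suc k) x - (S ^^ k) x) \<le> C * \<mu> ^ k"
proof -
  obtain L M N where mu: "\<mu> \<in> {0..<1}" and M: "M > 0"
    and le: "\<And>k. k > N \<Longrightarrow> onorm ((*v) (matrix_power (matrix S) k - L)) \<le> M * \<mu> ^ k"
    using assms(2) unfolding linearly_convergent_def by blast
  have d: "norm ((S ^^ k) x - L *v x) \<le> M * \<mu> ^ k * norm x" if "k > N" for k
  proof -
    have "norm ((S ^^ k) x - L *v x) = norm ((matrix_power (matrix S) k - L) *v x)"
      by (simp add: matrix_vector_mult_diff_rdistrib matrix_power_mult_vec[OF assms(1)])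
    also have "\<dots> \<le> onorm ((*v) (matrix_power (matrix S) k - L)) * norm x"
      by (intro onorm matrix_vector_mul_bounded_linear)
    also have "\<dots> \<le> M * \<mu> ^ k * norm x" by (intro mult_right_mono le that) simp
    finally show ?thesis .
  qed
  have "norm ((S ^^ Suc k) x - (S ^^ k) x) \<le> (2 * M * norm x) * \<mu> ^ k" if k: "k > N" for k
  proof -
    have "norm ((S ^^ Suc k) x - (S ^^ k) x)
        \<le> norm ((S ^^ Suc k) x - L *v x) + norm ((S ^^ k) x - L *v x)"
      by norm
    also have "\<dots> \<le> M * \<mu> ^ Suc k * norm x + M * \<mu> ^ k * norm x"
      using k by (intro add_mono d) auto
    also have "\<dots> \<le> M * \<mu> ^ k * norm x + M * \<mu> ^ k * norm x"
      using M mu by (intro add_mono mult_right_mono mult_left_mono power_decreasing) auto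
    finally show ?thesis by (simp add: mult_ac)
  qed
  then show ?thesis by (rule that)
qed

text \<open>Used with \<open>r = g / \<mu>\<close>: a rate \<open>\<mu>\<close> above
  \<open>g\<close> absorbs the linear factor, because \<open>real k * r ^ k\<close> tends to
  0.\<close>

lemma linear_times_power_bounded:
  fixes r C :: real
  assumes "0 \<le> r" "r < 1"
  obtains B where "B > 0" "\<And>k. r ^ k * (2 + real k * C) \<le> B"
proof -
  have "(\<lambda>k. 2 * r ^ k + C * (real k * r ^ k)) \<longlonglongrightarrow> 2 * 0 + C * 0"
    using assms by (intro tendsto_intros LIMSEQ_realpow_zero powser_times_n_limit_0) auto
  then have "Bseq (\<lambda>k. 2 * r ^ k + C * (real k * r ^ k))"
    by (intro convergent_imp_Bseq convergentI)
  then obtain B where B: "B > 0" "\<And>k. norm (2 * r ^ k + C * (real k * r ^ k)) \<le> B"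
    by (auto elim: BseqE)
  show ?thesis
  proof (rule that[OF B(1)])
    fix k show "r ^ k * (2 + real k * C) \<le> B"
      using B(2)[of k] by (simp add: algebra_simps)
  qed
qed

lemma opt_rate_props:
  assumes "\<theta> \<in> {0<..<pi/2}"
  shows "0 < sin \<theta>" "sin \<theta> < 1" "0 < cos \<theta>" "cos \<theta> < 1"
    and "0 < opt_rate \<theta>" "opt_rate \<theta> < 1" "opt_relaxation \<theta> = 1 + opt_rate \<theta>"
    and "(1 + opt_rate \<theta>) * sin \<theta> = 1 - opt_rate \<theta>"
    and "(1 + opt_rate \<theta>)\<^sup>2 * (cos \<theta>)\<^sup>2 = 4 * opt_rate \<theta>"
proof -
  show s: "0 < sin \<theta>" using assms by (intro sin_gt_zero2) auto
  show c: "0 < cos \<theta>" using assms by (intro cos_gt_zero) auto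
  have sc: "(sin \<theta>)\<^sup>2 + (cos \<theta>)\<^sup>2 = 1" by simp
  have "(sin \<theta>)\<^sup>2 < 1\<^sup>2" "(cos \<theta>)\<^sup>2 < 1\<^sup>2" using s c sc by (smt (verit) one_power2 zero_less_power)+
  then show s1: "sin \<theta> < 1" and "cos \<theta> < 1"
    using power_less_imp_less_base[of _ 2 1] by auto
  show "0 < opt_rate \<theta>" "opt_rate \<theta> < 1" "opt_relaxation \<theta> = 1 + opt_rate \<theta>"
    "(1 + opt_rate \<theta>) * sin \<theta> = 1 - opt_rate \<theta>"
    using s s1 by (simp_all add: opt_rate_def opt_relaxation_def field_simps)
  then have "(1 + opt_rate \<theta>)\<^sup>2 * (sin \<theta>)\<^sup>2 = (1 - opt_rate \<theta>)\<^sup>2"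
    by (metis power_mult_distrib)
  then have "(1 + opt_rate \<theta>)\<^sup>2 * (cos \<theta>)\<^sup>2 = (1 + opt_rate \<theta>)\<^sup>2 - (1 - opt_rate \<theta>)\<^sup>2"
    by (simp add: cos_squared_eq right_diff_distrib)
  also have "\<dots> = 4 * opt_rate \<theta>" by (simp add: power2_eq_square algebra_simps)
  finally show "(1 + opt_rate \<theta>)\<^sup>2 * (cos \<theta>)\<^sup>2 = 4 * opt_rate \<theta>" .
qed

lemma gap_operator_opt_linearly_convergent:
  fixes U V :: "(real^'n) set"
  assumes U: "subspace U" and V: "subspace V" and \<theta>: "\<theta> \<in> {0<..<pi/2}"
    and F: "friedrichs_angle U V \<theta>" and \<mu>: "\<mu> \<in> {opt_rate \<theta><..<1}"
  shows "linearly_convergent (matrix (gap_operator 1 (opt_relaxation \<theta>) (opt_relaxation \<theta>) U V)) \<mu>"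
proof -
  note props = opt_rate_props[OF \<theta>]
  let ?g = "opt_rate \<theta>" let ?T = "gap_operator 1 (opt_relaxation \<theta>) (opt_relaxation \<theta>) U V"
  interpret friedrichs_pair U V "cos \<theta>"
    by unfold_locales (rule U V props friedrichs_angle_inner_le[OF U V F] | assumption)+
  interpret optimal_relaxation U V "cos \<theta>" ?g "opt_relaxation \<theta>"
    by unfold_locales (simp_all only: props)
  obtain C where C: "C > 0"
    "\<And>k x. norm ((?T ^^ k) x - closest_point (U \<inter> V) x) \<le> ?g ^ k * (2 + real k * C) * norm x"
    using T_power_bound by blast
  have \<mu>0: "0 < \<mu>" using \<mu> props by auto
  obtain B where B: "B > 0" "\<And>k. (?g / \<mu>) ^ k * (2 + real k * C) \<le> B"
    using linear_times_power_bounded[of "?g / \<mu>"] \<mu> \<mu>0 props by (auto simp: field_simps)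
  show ?thesis
  proof (rule linearly_convergentI)
    show "linear ?T" by (rule linear_gap_operator[OF U V])
    show "linear (closest_point (U \<inter> V))"
      by (rule linear_closest_point_subspace[OF subspace_inter[OF U V]])
    show "\<mu> \<in> {0..<1}" using \<mu> \<mu>0 by simp
    show "norm ((?T ^^ k) x - closest_point (U \<inter> V) x) \<le> B * \<mu> ^ k * norm x" for k x
    proof -
      have "?g ^ k * (2 + real k * C) = \<mu> ^ k * ((?g / \<mu>) ^ k * (2 + real k * C))"
        using \<mu>0 by (simp add: power_divide)
      also have "\<dots> \<le> \<mu> ^ k * B" using \<mu>0 B(2) by (intro mult_left_mono) auto
      finally show ?thesis
        using C(2)[of k x] mult_right_mono[of _ _ "norm x"] by (smt (verit) mult.commute norm_ge_zero)
    qed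
  qed (rule B)
qed

section \<open>Necessity\<close>

text \<open>For \<open>0 \<le> g\<close> and \<open>g < 1\<close> this says that the limsup of the
  k-th roots of \<open>\<bar>z k\<bar>\<close> is at most \<open>g\<close>. Ranging over all
  \<open>\<mu>\<close> above \<open>g\<close> mirrors the convergence with any rate in the
  theorem.\<close>

definition geometric_decay :: "real \<Rightarrow> (nat \<Rightarrow> real) \<Rightarrow> bool" where
  "geometric_decay g z \<longleftrightarrow> (\<forall>\<mu>\<in>{g<..<1}. \<exists>C N. \<forall>k>N. \<bar>z k\<bar> \<le> C * \<mu> ^ k)"

lemma geometric_decay_mono:
  assumes "geometric_decay g y" "\<And>k. \<bar>z k\<bar> \<le> \<bar>y k\<bar>"
  shows "geometric_decay g z"
  using assms unfolding geometric_decay_def by (meson order_trans)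

lemma geometric_decay_cmult:
  assumes "geometric_decay g z"
  shows "geometric_decay g (\<lambda>k. c * z k)"
  unfolding geometric_decay_def
proof
  fix \<mu> assume "\<mu> \<in> {g<..<1}"
  then obtain C N where "\<forall>k>N. \<bar>z k\<bar> \<le> C * \<mu> ^ k"
    using assms unfolding geometric_decay_def by blast
  then have "\<forall>k>N. \<bar>c * z k\<bar> \<le> (\<bar>c\<bar> * C) * \<mu> ^ k"
    by (simp add: abs_mult mult.assoc mult_left_mono)
  then show "\<exists>C N. \<forall>k>N. \<bar>c * z k\<bar> \<le> C * \<mu> ^ k" by blast
qed

lemma geometric_decay_add:
  assumes "geometric_decay g y" "geometric_decay g z"
  shows "geometric_decay g (\<lambda>k. y k + z k)"
  unfolding geometric_decay_def
proof
  fix \<mu> assume \<mu>: "\<mu> \<in> {g<..<1}"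
  obtain C N where 1: "\<forall>k>N. \<bar>y k\<bar> \<le> C * \<mu> ^ k"
    using assms(1) \<mu> unfolding geometric_decay_def by blast
  obtain D K where 2: "\<forall>k>K. \<bar>z k\<bar> \<le> D * \<mu> ^ k"
    using assms(2) \<mu> unfolding geometric_decay_def by blast
  have "\<bar>y k + z k\<bar> \<le> (C + D) * \<mu> ^ k" if "k > N + K" for k
    using abs_triangle_ineq[of "y k" "z k"] 1 2 that
      add_mono[of "\<bar>y k\<bar>" "C * \<mu> ^ k" "\<bar>z k\<bar>" "D * \<mu> ^ k"] by (simp add: distrib_right)
  then show "\<exists>C N. \<forall>k>N. \<bar>y k + z k\<bar> \<le> C * \<mu> ^ k" by blast
qed

lemma geometric_decay_abs:
  assumes "geometric_decay g z"
  shows "geometric_decay g (\<lambda>k. \<bar>z k\<bar>)"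
  using assms by (simp add: geometric_decay_def)

lemma geometric_decay_Suc:
  assumes "geometric_decay g z"
  shows "geometric_decay g (\<lambda>k. z (Suc k))"
  unfolding geometric_decay_def
proof
  fix \<mu> assume "\<mu> \<in> {g<..<1}"
  then obtain C N where "\<forall>k>N. \<bar>z k\<bar> \<le> C * \<mu> ^ k"
    using assms unfolding geometric_decay_def by blast
  then have "\<forall>k>N. \<bar>z (Suc k)\<bar> \<le> (C * \<mu>) * \<mu> ^ k"
    by (metis less_SucI mult.assoc power_Suc)
  then show "\<exists>C N. \<forall>k>N. \<bar>z (Suc k)\<bar> \<le> C * \<mu> ^ k" by blast
qed

text \<open>Otherwise a rate \<open>\<mu>\<close> strictly between \<open>g\<close> and
  \<open>\<bar>r\<bar>\<close> would keep the powers of \<open>\<bar>r\<bar> / \<mu>\<close>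
  bounded, although this ratio exceeds 1.\<close>

lemma geometric_decay_power:
  assumes z: "geometric_decay g (\<lambda>k. e * r ^ k)" and e: "e \<noteq> 0" and g: "0 \<le> g" "g < 1"
  shows "\<bar>r\<bar> \<le> g"
proof (rule ccontr)
  assume "\<not> \<bar>r\<bar> \<le> g"
  then obtain \<mu> where \<mu>: "g < \<mu>" "\<mu> < 1" "\<mu> < \<bar>r\<bar>"
    using dense[of g "min 1 \<bar>r\<bar>"] g by auto
  have \<mu>0: "0 < \<mu>" using \<mu> g by simp
  obtain C N where C: "\<And>k. k > N \<Longrightarrow> \<bar>e * r ^ k\<bar> \<le> C * \<mu> ^ k"
    using z \<mu> unfolding geometric_decay_def by (meson greaterThanLessThan_iff)
  have q: "1 < \<bar>r\<bar> / \<mu>" using \<mu> \<mu>0 by simp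
  obtain n where n: "C / \<bar>e\<bar> < (\<bar>r\<bar> / \<mu>) ^ n" using real_arch_pow[OF q] by blast
  let ?k = "n + N + 1"
  have "(\<bar>r\<bar> / \<mu>) ^ n \<le> (\<bar>r\<bar> / \<mu>) ^ ?k" using q by (intro power_increasing) auto
  with n have "C / \<bar>e\<bar> < \<bar>r\<bar> ^ ?k / \<mu> ^ ?k" by (simp only: power_divide)
  moreover have "\<bar>e\<bar> * \<bar>r\<bar> ^ ?k \<le> C * \<mu> ^ ?k"
    using C[of ?k] by (simp only: abs_mult power_abs)
  moreover have "0 < \<mu> ^ ?k" using \<mu>0 by (rule zero_less_power)
  ultimately show False using e by (simp only: field_simps) (simp add: field_simps)
qed

text \<open>The roots of \<open>X\<^sup>2 - t X + d\<close> have modulus at most \<open>g\<close>; for conjugate roots this is read off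
  the Casoratian of \<open>z\<close>, which is a multiple of \<open>d ^ k\<close>.\<close>

lemma second_order_decay:
  fixes z :: "nat \<Rightarrow> real"
  assumes z: "geometric_decay g z" and g: "0 \<le> g" "g < 1"
    and rec: "\<And>k. z (Suc (Suc k)) = t * z (Suc k) - d * z k"
    and init: "z 0 = 0" "z (Suc 0) \<noteq> 0"
  shows "t \<le> 2 * g \<and> 0 \<le> g\<^sup>2 - t * g + d"
proof (cases "4 * d \<le> t\<^sup>2")
  case True
  have root: "\<bar>\<sigma>\<bar> \<le> g" if "\<sigma> + \<tau> = t" "\<sigma> * \<tau> = d" for \<sigma> \<tau>
  proof -
    \<comment> \<open>Subtracting \<open>\<tau>\<close> times the previous term removes the mode of
      \<open>\<tau>\<close>; since \<open>z 0 = 0\<close>, the mode of \<open>\<sigma>\<close>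
      remains with the nonzero coefficient \<open>z (Suc 0)\<close>.\<close>
    have "z (Suc k) + - \<tau> * z k = z (Suc 0) * \<sigma> ^ k" for k
    proof (induction k)
      case (Suc k)
      have "z (Suc (Suc k)) + - \<tau> * z (Suc k) = \<sigma> * (z (Suc k) + - \<tau> * z k)"
        unfolding rec that[symmetric] by (simp add: algebra_simps)
      then show ?case using Suc by simp
    qed (simp add: init)
    moreover have "geometric_decay g (\<lambda>k. z (Suc k) + - \<tau> * z k)"
      by (intro geometric_decay_add geometric_decay_Suc geometric_decay_cmult z)
    ultimately have "geometric_decay g (\<lambda>k. z (Suc 0) * \<sigma> ^ k)" by simp
    then show ?thesis using init(2) g by (rule geometric_decay_power)
  qed
  define w where "w = sqrt (t\<^sup>2 - 4 * d)"
  have w: "w * w = t * t - 4 * d" using True by (simp add: w_def power2_eq_square)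
  define \<sigma> \<tau> where "\<sigma> = (t + w) / 2" and "\<tau> = (t - w) / 2"
  have st: "\<sigma> + \<tau> = t" "\<sigma> * \<tau> = d" using w by (simp_all add: \<sigma>_def \<tau>_def field_simps)
  have "\<bar>\<sigma>\<bar> \<le> g" "\<bar>\<tau>\<bar> \<le> g"
    using root[of \<sigma> \<tau>] root[of \<tau> \<sigma>] st by (simp_all add: add.commute mult.commute)
  then have "0 \<le> (g - \<sigma>) * (g - \<tau>)" "\<sigma> + \<tau> \<le> 2 * g" by simp_all
  then show ?thesis unfolding st(1)[symmetric] st(2)[symmetric]
    by (simp add: power2_eq_square algebra_simps)
next
  case False
  have d: "0 < d" using False zero_le_power2[of t] by linarith
  have cas: "(z (Suc k))\<^sup>2 - z k * z (Suc (Suc k)) = d ^ k * (z (Suc 0))\<^sup>2" for k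
  proof (induction k)
    case (Suc k)
    have "(z (Suc (Suc k)))\<^sup>2 - z (Suc k) * z (Suc (Suc (Suc k)))
        = d * ((z (Suc k))\<^sup>2 - z k * z (Suc (Suc k)))"
      unfolding rec[of "Suc k"] unfolding rec[of k] by (simp add: power2_eq_square algebra_simps)
    then show ?case using Suc by simp
  qed (simp add: init)
  \<comment> \<open>The square of this sum dominates the Casoratian, so \<open>sqrt d ^ k\<close>
    inherits the decay of \<open>z\<close>.\<close>
  let ?y = "\<lambda>k. \<bar>z k\<bar> + (\<bar>z (Suc k)\<bar> + \<bar>z (Suc (Suc k))\<bar>)"
  have "\<bar>z (Suc 0) * sqrt d ^ k\<bar> \<le> \<bar>?y k\<bar>" for k
  proof (rule power2_le_imp_le)
    have "(sqrt d ^ k)\<^sup>2 = ((sqrt d)\<^sup>2) ^ k" by (simp only: mult.commute flip: power_mult)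
    also have "\<dots> = d ^ k" using d by simp
    finally have sq: "(sqrt d ^ k)\<^sup>2 = d ^ k" .
    have "\<bar>z (Suc 0) * sqrt d ^ k\<bar>\<^sup>2 = d ^ k * (z (Suc 0))\<^sup>2"
      using d by (simp add: power_mult_distrib sq)
    also have "\<dots> = (z (Suc k))\<^sup>2 - z k * z (Suc (Suc k))" by (rule cas[symmetric])
    also have "\<dots> \<le> \<bar>z (Suc k)\<bar>\<^sup>2 + \<bar>z k\<bar> * \<bar>z (Suc (Suc k))\<bar>"
      using abs_ge_minus_self[of "z k * z (Suc (Suc k))"] by (simp add: abs_mult)
    also have "\<dots> \<le> (?y k)\<^sup>2"
      by (simp add: power2_eq_square distrib_left distrib_right)
    finally show "\<bar>z (Suc 0) * sqrt d ^ k\<bar>\<^sup>2 \<le> \<bar>?y k\<bar>\<^sup>2" by simp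
  qed simp
  moreover have "geometric_decay g ?y"
    by (intro geometric_decay_add geometric_decay_abs geometric_decay_Suc[of g z]
      geometric_decay_Suc[of g "\<lambda>k. z (Suc k)"] z)
  ultimately have "geometric_decay g (\<lambda>k. z (Suc 0) * sqrt d ^ k)"
    by (rule geometric_decay_mono[rotated])
  then have "\<bar>sqrt d\<bar> \<le> g" using init(2) g by (rule geometric_decay_power)
  then have sg: "sqrt d \<le> g" by simp
  have "t\<^sup>2 \<le> (2 * sqrt d)\<^sup>2" using False d by (simp add: power_mult_distrib)
  then have t: "t \<le> 2 * sqrt d" by (rule power2_le_imp_le) (use d in simp)
  have "0 \<le> (g - sqrt d)\<^sup>2" by simp
  also have "\<dots> = g\<^sup>2 - 2 * sqrt d * g + d" using d by (simp add: power2_diff)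
  also have "\<dots> \<le> g\<^sup>2 - t * g + d" using mult_right_mono[OF t g(1)] by simp
  finally show ?thesis using t sg by simp
qed

section \<open>The equality case for the parameters\<close>

text \<open>Let p(X) = X^2 - t X + d. By \<open>td\<close>, p(1) is at least
  \<open>(1 - g)\<^sup>2\<close>; since \<open>\<alpha> * a\<close> and \<open>\<alpha> * b\<close>
  are at most \<open>1 + g\<close>, it is also at most \<open>(1 + g)\<^sup>2 * s\<^sup>2\<close>,
  the same number. Equality throughout fixes all parameters.\<close>

lemma gap_parameters_unique:
  fixes \<alpha> a b c g s t d :: real
  assumes pos: "0 < \<alpha>" "0 < a" "0 < b" "0 < g" "g < 1" "0 < s"
    and gs: "(1 + g) * s = 1 - g" and gc: "(1 + g)\<^sup>2 * c\<^sup>2 = 4 * g"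
    and ab: "\<bar>1 - \<alpha> * a\<bar> \<le> g" "\<bar>1 - \<alpha> * b\<bar> \<le> g"
    and t: "t = 2 - \<alpha> * (a + b - a * b * c\<^sup>2)" and d: "1 - t + d = \<alpha>\<^sup>2 * a * b * s\<^sup>2"
    and td: "t \<le> 2 * g" "0 \<le> g\<^sup>2 - t * g + d"
  shows "\<alpha> = 1 \<and> a = 1 + g \<and> b = 1 + g"
proof -
  define u v where "u = \<alpha> * a" and "v = \<alpha> * b"
  have uv: "u \<le> 1 + g" "v \<le> 1 + g" "0 < u" "0 < v" using ab pos by (auto simp: u_def v_def)
  have duv: "1 - t + d = (u * v) * s\<^sup>2" by (simp add: d u_def v_def power2_eq_square)
  \<comment> \<open>Taylor expansion of p around \<open>g\<close> at the point 1, with p(g) and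
    p'(g) = \<open>2 * g - t\<close> both nonnegative.\<close>
  have id: "1 - t + d = (1 - g)\<^sup>2 + (g\<^sup>2 - t * g + d) + (2 * g - t) * (1 - g)"
    by (simp add: power2_eq_square algebra_simps)
  have gs2: "(1 - g)\<^sup>2 = (1 + g)\<^sup>2 * s\<^sup>2" by (metis gs power_mult_distrib)
  have le: "u * v \<le> (1 + g)\<^sup>2" using uv mult_mono[of u "1 + g" v "1 + g"] pos
    by (simp add: power2_eq_square)
  have nn: "0 \<le> (2 * g - t) * (1 - g)" using td pos by simp
  have "(1 + g)\<^sup>2 * s\<^sup>2 \<le> (u * v) * s\<^sup>2" using id duv gs2 td nn by linarith
  then have eq: "u * v = (1 + g)\<^sup>2" using le pos by simp
  have "(1 + g) * (1 + g) \<le> u * (1 + g)" using eq uv mult_left_mono[of v "1 + g" u]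
    by (simp add: power2_eq_square)
  then have u: "u = 1 + g" using uv pos by simp
  then have v: "v = 1 + g" using eq pos by (simp add: power2_eq_square)
  have "(2 * g - t) * (1 - g) = 0" using id duv[unfolded eq] gs2 td nn by linarith
  then have t2: "t = 2 * g" using pos by simp
  \<comment> \<open>After multiplication by \<open>\<alpha>\<close>, \<open>a\<close> and
    \<open>b\<close> enter only through the known \<open>u\<close> and \<open>v\<close>, leaving a
    linear equation for \<open>\<alpha>\<close>.\<close>
  have "\<alpha> * t = 2 * \<alpha> - \<alpha> * u - \<alpha> * v + (u * v) * c\<^sup>2"
    by (simp add: t u_def v_def algebra_simps)
  then have "\<alpha> * (2 * g) = 2 * \<alpha> - 2 * (\<alpha> * (1 + g)) + 4 * g" by (simp add: t2 u v eq[unfolded u v] gc)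
  then have "g * \<alpha> = g" by (simp add: algebra_simps)
  then have "\<alpha> = 1" using pos by simp
  then show ?thesis using u v by (simp add: u_def v_def)
qed

section \<open>A line and a plane at a given angle\<close>

locale orthonormal_triple =
  fixes e\<^sub>1 e\<^sub>2 e\<^sub>3 :: "real^'n" and \<theta> :: real
  assumes unit: "e\<^sub>1 \<bullet> e\<^sub>1 = 1" "e\<^sub>2 \<bullet> e\<^sub>2 = 1" "e\<^sub>3 \<bullet> e\<^sub>3 = 1"
    and orth: "e\<^sub>1 \<bullet> e\<^sub>2 = 0" "e\<^sub>1 \<bullet> e\<^sub>3 = 0" "e\<^sub>2 \<bullet> e\<^sub>3 = 0"
    and \<theta>: "\<theta> \<in> {0<..<pi/2}"
begin

lemma orth': "e\<^sub>2 \<bullet> e\<^sub>1 = 0" "e\<^sub>3 \<bullet> e\<^sub>1 = 0" "e\<^sub>3 \<bullet> e\<^sub>2 = 0"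
  using orth by (simp_all add: inner_commute)

definition f where "f = cos \<theta> *\<^sub>R e\<^sub>1 + sin \<theta> *\<^sub>R e\<^sub>2"
abbreviation "U \<equiv> span {e\<^sub>1}"
abbreviation "V \<equiv> span {f, e\<^sub>3}"

lemma cs: "0 < sin \<theta>" "0 < cos \<theta>"
  by (rule opt_rate_props[OF \<theta>])+

lemma f_inner: "f \<bullet> f = 1" "f \<bullet> e\<^sub>1 = cos \<theta>" "e\<^sub>1 \<bullet> f = cos \<theta>" "f \<bullet> e\<^sub>2 = sin \<theta>" "f \<bullet> e\<^sub>3 = 0" "e\<^sub>3 \<bullet> f = 0"
  using sin_cos_squared_add2[of \<theta>]
  by (simp_all add: f_def inner_add unit orth orth' power2_eq_square add.commute)

lemma U_iff: "x \<in> U \<longleftrightarrow> (\<exists>k. x = k *\<^sub>R e\<^sub>1)"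
  by (auto simp: span_singleton)

lemma V_iff: "x \<in> V \<longleftrightarrow> (\<exists>k l. x = k *\<^sub>R f + l *\<^sub>R e\<^sub>3)"
proof -
  have "x \<in> V \<longleftrightarrow> (\<exists>k l. x - k *\<^sub>R f = l *\<^sub>R e\<^sub>3)"
    unfolding span_breakdown_eq[of x f] span_singleton by blast
  then show ?thesis by (simp only: diff_eq_eq add.commute)
qed

lemma dim_U: "dim U = 1" and dim_V: "dim V = 2"
proof -
  have "e\<^sub>1 \<noteq> 0" "f \<noteq> 0" "e\<^sub>3 \<noteq> 0" "f \<noteq> e\<^sub>3" using unit f_inner by auto
  moreover have "independent {f, e\<^sub>3}"
    using calculation f_inner
    by (intro pairwise_orthogonal_independent) (auto simp: pairwise_def orthogonal_def)
  ultimately show "dim U = 1" "dim V = 2"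
    by (simp_all add: dim_span dim_eq_card_independent)
qed

lemma U_Int_V: "U \<inter> V = {0}"
proof -
  have "x = 0" if x: "x \<in> U" "x \<in> V" for x
  proof -
    obtain k where k: "x = k *\<^sub>R e\<^sub>1" using x U_iff by blast
    obtain l m where lm: "x = l *\<^sub>R f + m *\<^sub>R e\<^sub>3" using x V_iff by blast
    have "x \<bullet> e\<^sub>2 = l * sin \<theta>" by (simp add: lm inner_add f_inner orth orth')
    moreover have "x \<bullet> e\<^sub>2 = 0" by (simp add: k orth)
    ultimately have "l = 0" using cs by simp
    then have "x \<bullet> e\<^sub>1 = 0" by (simp add: lm orth orth')
    then show ?thesis using k unit by simp
  qed
  then show ?thesis using span_0 by blast
qed

text \<open>The intersection is trivial, so the Friedrichs angle is the first principal angle, where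
  no orthogonality is imposed yet. As \<open>U\<close> is a line it is also the only one, and
  constant families serve as maximizers.\<close>

lemma friedrichs_angle_UV: "friedrichs_angle U V \<theta>"
proof -
  have le: "x \<bullet> y \<le> cos \<theta>" if xy: "x \<in> U" "y \<in> V" "norm x = 1" "norm y = 1" for x y
  proof -
    obtain k where k: "x = k *\<^sub>R e\<^sub>1" using xy U_iff by blast
    obtain l m where lm: "y = l *\<^sub>R f + m *\<^sub>R e\<^sub>3" using xy V_iff by blast
    have "norm e\<^sub>1 = 1" using unit by (simp add: norm_eq_1)
    then have k1: "\<bar>k\<bar> = 1" using xy k by simp
    have "y \<bullet> y = l * l + m * m" by (simp add: lm inner_add f_inner unit)
    then have "l * l + m * m = 1" using xy by (simp add: norm_eq_1)
    then have "l\<^sup>2 \<le> 1" by (simp add: power2_eq_square) (metis add_le_same_cancel1 le_add_same_cancel1 zero_le_square)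
    then have l1: "\<bar>l\<bar> \<le> 1" by (simp add: abs_square_le_1)
    have "\<bar>k * l\<bar> \<le> 1" using k1 l1 by (simp add: abs_mult)
    then have "k * l \<le> 1" by simp
    moreover have "x \<bullet> y = (k * l) * cos \<theta>" by (simp add: k lm inner_add f_inner orth)
    ultimately show ?thesis using cs by simp
  qed
  have "principal_vectors U V (\<lambda>_. e\<^sub>1) (\<lambda>_. f)"
    unfolding principal_vectors_def principal_feasible_def dim_U dim_V
    using le by (auto simp: f_inner unit norm_eq_1 span_base)
  then have "principal_angles U V (\<lambda>_. \<theta>)"
    unfolding principal_angles_def using \<theta> f_inner by fastforce
  moreover have "dim (U \<inter> V) < min (dim U) (dim V)" unfolding U_Int_V dim_U dim_V by simp
  ultimately show ?thesis unfolding friedrichs_angle_def by blast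
qed

lemma closest_point_U: "closest_point U x = (x \<bullet> e\<^sub>1) *\<^sub>R e\<^sub>1"
  by (rule closest_point_subspaceI) (auto simp: span_base span_scale U_iff inner_diff unit)

lemma closest_point_V: "closest_point V x = (x \<bullet> f) *\<^sub>R f + (x \<bullet> e\<^sub>3) *\<^sub>R e\<^sub>3"
  by (rule closest_point_subspaceI)
    (auto simp: span_base span_scale span_add V_iff inner_diff inner_add f_inner unit)

text \<open>\<open>e\<^sub>3\<close> lies in \<open>V\<close> and is orthogonal to \<open>U\<close>,
  so only the relaxation attached to \<open>U\<close> acts on it. Exchanging the subspaces exposes
  the other parameter, which is why both orders are used.\<close>

lemma gap_operator_e3:
  "gap_operator \<alpha> a b U V e\<^sub>3 = (1 - \<alpha> * b) *\<^sub>R e\<^sub>3"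
  "gap_operator \<alpha> a b V U e\<^sub>3 = (1 - \<alpha> * a) *\<^sub>R e\<^sub>3"
  by (simp_all add: gap_operator_def relaxed_projection_def closest_point_U closest_point_V
      f_inner unit orth orth' inner_add algebra_simps)

text \<open>The plane of \<open>e\<^sub>1\<close> and \<open>e\<^sub>2\<close> is invariant: it
  contains \<open>U\<close> and \<open>f\<close> and is orthogonal to \<open>e\<^sub>3\<close>. The
  trace and determinant of this 2 by 2 matrix feed \<open>second_order_decay\<close>.\<close>

lemma gap_operator_plane:
  "gap_operator \<alpha> a b U V (x *\<^sub>R e\<^sub>1 + y *\<^sub>R e\<^sub>2) =
    ((1 - \<alpha> + \<alpha> * (1 - a + a * (cos \<theta>)\<^sup>2)) * x + \<alpha> * a * cos \<theta> * sin \<theta> * y) *\<^sub>R e\<^sub>1 +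
    (\<alpha> * (1 - b) * a * cos \<theta> * sin \<theta> * x +
      (1 - \<alpha> + \<alpha> * (1 - b) * (1 - a + a * (sin \<theta>)\<^sup>2)) * y) *\<^sub>R e\<^sub>2"
  (is "?l = ?r")
proof -
  have Q: "closest_point V (x *\<^sub>R e\<^sub>1 + y *\<^sub>R e\<^sub>2)
      = (cos \<theta> * (cos \<theta> * x + sin \<theta> * y)) *\<^sub>R e\<^sub>1 + (sin \<theta> * (cos \<theta> * x + sin \<theta> * y)) *\<^sub>R e\<^sub>2"
    unfolding closest_point_V unfolding f_def
    by (simp add: inner_add unit orth orth' algebra_simps)
  have P: "closest_point U (k *\<^sub>R e\<^sub>1 + l *\<^sub>R e\<^sub>2) = k *\<^sub>R e\<^sub>1" for k l
    by (simp add: closest_point_U inner_add unit orth')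
  have R: "relaxed_projection a V (x *\<^sub>R e\<^sub>1 + y *\<^sub>R e\<^sub>2) =
      ((1 - a) * x + a * (cos \<theta> * (cos \<theta> * x + sin \<theta> * y))) *\<^sub>R e\<^sub>1 +
      ((1 - a) * y + a * (sin \<theta> * (cos \<theta> * x + sin \<theta> * y))) *\<^sub>R e\<^sub>2"
    unfolding relaxed_projection_def Q by (simp add: scaleR_add_left scaleR_add_right)
  show ?thesis
    unfolding gap_operator_def R unfolding relaxed_projection_def P
    by (simp add: power2_eq_square algebra_simps)
qed

lemma gap_parameters_optimal:
  assumes pos: "0 < \<alpha>" "0 < a" "0 < b"
    and conv: "\<And>\<mu>. \<mu> \<in> {opt_rate \<theta><..<1} \<Longrightarrow> linearly_convergent (matrix (gap_operator \<alpha> a b U V)) \<mu>"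
    and conv': "\<And>\<mu>. \<mu> \<in> {opt_rate \<theta><..<1} \<Longrightarrow> linearly_convergent (matrix (gap_operator \<alpha> a b V U)) \<mu>"
  shows "\<alpha> = 1 \<and> a = opt_relaxation \<theta> \<and> b = opt_relaxation \<theta>"
proof -
  note props = opt_rate_props[OF \<theta>]
  let ?g = "opt_rate \<theta>"
  have decay: "geometric_decay ?g (\<lambda>k. ((S ^^ Suc k) x - (S ^^ k) x) \<bullet> w)"
    if lin: "linear S" and S: "\<And>\<mu>. \<mu> \<in> {?g<..<1} \<Longrightarrow> linearly_convergent (matrix S) \<mu>"
      and w: "w \<bullet> w = 1"
    for S :: "real^'n \<Rightarrow> real^'n" and x w
    unfolding geometric_decay_def
  proof
    fix \<mu> assume \<mu>: "\<mu> \<in> {?g<..<1}"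
    obtain C N where C: "\<And>k. k > N \<Longrightarrow> norm ((S ^^ Suc k) x - (S ^^ k) x) \<le> C * \<mu> ^ k"
      using linearly_convergentD[OF lin S[OF \<mu>], of x] by blast
    have "norm w = 1" using w by (simp add: norm_eq_1)
    then have "\<bar>((S ^^ Suc k) x - (S ^^ k) x) \<bullet> w\<bar> \<le> C * \<mu> ^ k" if "k > N" for k
      using C[OF that] Cauchy_Schwarz_ineq2[of "(S ^^ Suc k) x - (S ^^ k) x" w] by simp
    then show "\<exists>C N. \<forall>k>N. \<bar>((S ^^ Suc k) x - (S ^^ k) x) \<bullet> w\<bar> \<le> C * \<mu> ^ k" by blast
  qed
  \<comment> \<open>Consecutive differences carry the factor \<open>r - 1\<close>, hence the
    exclusion of the eigenvalue 1.\<close>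
  have eigenvalue: "\<bar>r\<bar> \<le> ?g"
    if "linear S" and S: "\<And>\<mu>. \<mu> \<in> {?g<..<1} \<Longrightarrow> linearly_convergent (matrix S) \<mu>"
      and w: "w \<bullet> w = 1" "S w = r *\<^sub>R w" and r: "r \<noteq> 1"
    for S :: "real^'n \<Rightarrow> real^'n" and w r
  proof -
    have "(S ^^ k) w = r ^ k *\<^sub>R w" for k
      by (induction k) (simp_all add: w linear_scale[OF \<open>linear S\<close>] mult.commute)
    then have "((S ^^ Suc k) w - (S ^^ k) w) \<bullet> w = (r - 1) * r ^ k" for k
      by (simp add: inner_diff w algebra_simps del: funpow.simps)
    then have "geometric_decay ?g (\<lambda>k. (r - 1) * r ^ k)" using decay[OF that(1,2) w(1), of w] by simp
    then show ?thesis using r props by (intro geometric_decay_power[of ?g "r - 1"]) auto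
  qed
  let ?S = "gap_operator \<alpha> a b U V"
  have S: "linear ?S" "linear (gap_operator \<alpha> a b V U)" by (intro linear_gap_operator subspace_span)+
  have b: "\<bar>1 - \<alpha> * b\<bar> \<le> ?g"
    using eigenvalue[OF S(1) conv unit(3) gap_operator_e3(1)] pos by simp
  have a: "\<bar>1 - \<alpha> * a\<bar> \<le> ?g"
    using eigenvalue[OF S(2) conv' unit(3) gap_operator_e3(2)] pos by simp
  define p q r m where "p = 1 - \<alpha> + \<alpha> * (1 - a + a * (cos \<theta>)\<^sup>2)" and "q = \<alpha> * a * cos \<theta> * sin \<theta>"
    and "r = \<alpha> * (1 - b) * a * cos \<theta> * sin \<theta>"
    and "m = 1 - \<alpha> + \<alpha> * (1 - b) * (1 - a + a * (sin \<theta>)\<^sup>2)"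
  \<comment> \<open>The iteration starts at \<open>f\<close>, which lies in \<open>V\<close>, so its
    first step changes only the \<open>e\<^sub>2\<close>-coordinate. The differences
    \<open>z\<close> of the \<open>e\<^sub>1\<close>-coordinates thus start with 0, followed by the
    nonzero \<open>- q * (\<alpha> * b * sin \<theta>)\<close>.\<close>
  define x where "x k = (?S ^^ k) f \<bullet> e\<^sub>1" for k
  define y where "y k = (?S ^^ k) f \<bullet> e\<^sub>2" for k
  have step: "?S (k *\<^sub>R e\<^sub>1 + l *\<^sub>R e\<^sub>2) = (p * k + q * l) *\<^sub>R e\<^sub>1 + (r * k + m * l) *\<^sub>R e\<^sub>2" for k l
    unfolding p_def q_def r_def m_def by (rule gap_operator_plane)
  have xy: "(?S ^^ k) f = x k *\<^sub>R e\<^sub>1 + y k *\<^sub>R e\<^sub>2" for k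
  proof (induction k)
    case 0
    show ?case by (simp add: x_def y_def f_inner) (simp add: f_def)
  next
    case (Suc k)
    have "(?S ^^ Suc k) f = (p * x k + q * y k) *\<^sub>R e\<^sub>1 + (r * x k + m * y k) *\<^sub>R e\<^sub>2"
      by (simp add: Suc step)
    then show ?case unfolding x_def[of "Suc k"] y_def[of "Suc k"]
      by (simp add: inner_add unit orth orth' del: funpow.simps)
  qed
  have Suc: "x (Suc k) = p * x k + q * y k" "y (Suc k) = r * x k + m * y k" for k
    using xy[of k] step unfolding x_def[of "Suc k"] y_def[of "Suc k"]
    by (simp_all add: inner_add unit orth orth')
  let ?t = "p + m" let ?d = "p * m - q * r"
  define z where "z k = x (Suc k) - x k" for k
  \<comment> \<open>Cayley-Hamilton for the matrix with entries \<open>p\<close>, \<open>q\<close>,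
    \<open>r\<close>, \<open>m\<close>.\<close>
  have rec: "x (Suc (Suc k)) = ?t * x (Suc k) - ?d * x k" for k
    by (simp add: Suc algebra_simps)
  have x0: "x 0 = cos \<theta>" "y 0 = sin \<theta>" by (simp_all add: x_def y_def f_inner)
  have ss: "sin \<theta> * sin \<theta> = 1 - cos \<theta> * cos \<theta>"
    using sin_squared_eq[of \<theta>] by (simp add: power2_eq_square)
  have z0: "x (Suc 0) = x 0"
    by (simp add: Suc x0 p_def q_def power2_eq_square ss algebra_simps)
  have y1: "y (Suc 0) = y 0 - \<alpha> * b * sin \<theta>"
    by (simp add: Suc x0 r_def m_def power2_eq_square ss algebra_simps)
  have "x (Suc (Suc 0)) = x (Suc 0) - q * (\<alpha> * b * sin \<theta>)"
  proof -
    have "x (Suc (Suc 0)) = p * x 0 + q * (y 0 - \<alpha> * b * sin \<theta>)"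
      unfolding Suc(1)[of "Suc 0"] z0 y1 ..
    also have "\<dots> = x (Suc 0) - q * (\<alpha> * b * sin \<theta>)"
      unfolding Suc(1)[of 0] by (simp add: algebra_simps)
    finally show ?thesis .
  qed
  then have z1: "z (Suc 0) \<noteq> 0" using pos cs by (simp add: z_def q_def)
  have zd: "geometric_decay ?g z"
    using decay[OF S(1) conv unit(1), of f] unfolding z_def x_def by (simp add: inner_diff_left)
  have "?t \<le> 2 * ?g \<and> 0 \<le> ?g\<^sup>2 - ?t * ?g + ?d"
  proof (rule second_order_decay[OF zd _ _ _ _ z1])
    show "z (Suc (Suc k)) = ?t * z (Suc k) - ?d * z k" for k
      unfolding z_def rec[of "Suc k"] unfolding rec[of k] by (simp add: algebra_simps)
    show "z 0 = 0" using z0 by (simp add: z_def)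
  qed (use props in auto)
  moreover have "?t = 2 - \<alpha> * (a + b - a * b * (cos \<theta>)\<^sup>2)"
    by (simp add: p_def m_def power2_eq_square ss algebra_simps)
  moreover have "1 - ?t + ?d = \<alpha>\<^sup>2 * a * b * (sin \<theta>)\<^sup>2"
    by (simp add: p_def m_def q_def r_def power2_eq_square ss algebra_simps)
  ultimately show ?thesis
    unfolding props(7) using pos props(5,6,8,9) cs a b
    by (intro gap_parameters_unique[of \<alpha> a b ?g "sin \<theta>" "cos \<theta>" ?t ?d]) blast+
qed

end

section \<open>The equivalence\<close>

theorem theorem2:
  fixes \<theta>\<^sub>F \<alpha> \<alpha>\<^sub>1 \<alpha>\<^sub>2 :: real
  assumes "CARD('n::finite) \<ge> 3"
    and "\<theta>\<^sub>F \<in> {0<..<pi/2}"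
    and "\<alpha> > 0" "\<alpha>\<^sub>1 > 0" "\<alpha>\<^sub>2 > 0"
  shows "(\<forall>U V :: (real^'n) set.
            subspace U \<and> subspace V \<and>
            dim U \<in> {1..CARD('n) - 1} \<and> dim V \<in> {1..CARD('n) - 1} \<and>
            (dim U < dim V \<or> dim U = dim V \<or> dim U > dim V) \<and>
            friedrichs_angle U V \<theta>\<^sub>F \<longrightarrow>
            (\<forall>\<mu>\<in>{opt_rate \<theta>\<^sub>F<..<1}.
               linearly_convergent (matrix (gap_operator \<alpha> \<alpha>\<^sub>1 \<alpha>\<^sub>2 U V)) \<mu>))
         \<longleftrightarrow> \<alpha> = 1 \<and> \<alpha>\<^sub>1 = opt_relaxation \<theta>\<^sub>F \<and> \<alpha>\<^sub>2 = opt_relaxation \<theta>\<^sub>F"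
    (is "?conv \<longleftrightarrow> ?opt")
proof
  assume ?opt
  then show ?conv using gap_operator_opt_linearly_convergent[OF _ _ assms(2)] by blast
next
  assume conv: ?conv
  obtain I :: "'n set" where "card I = 3"
    using obtain_subset_with_card_n[OF assms(1)] by blast
  then obtain i j k :: 'n where ijk: "i \<noteq> j" "i \<noteq> k" "j \<noteq> k" by (auto simp: card_3_iff)
  interpret orthonormal_triple "axis i 1" "axis j 1" "axis k 1 :: real^'n" \<theta>\<^sub>F
    using ijk assms(2) by unfold_locales (auto simp: inner_axis_axis)
  have "linearly_convergent (matrix (gap_operator \<alpha> \<alpha>\<^sub>1 \<alpha>\<^sub>2 U V)) \<mu>"
    "linearly_convergent (matrix (gap_operator \<alpha> \<alpha>\<^sub>1 \<alpha>\<^sub>2 V U)) \<mu>"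
    if "\<mu> \<in> {opt_rate \<theta>\<^sub>F<..<1}" for \<mu>
  proof -
    \<comment> \<open>The line and the plane are an instance of p < q and, in the other order, of p
      > q; the dimension 2 is allowed because n is at least 3.\<close>
    have "1 \<in> {1..CARD('n) - 1}" "2 \<in> {1..CARD('n) - 1}" using assms(1) by simp_all
    then show "linearly_convergent (matrix (gap_operator \<alpha> \<alpha>\<^sub>1 \<alpha>\<^sub>2 U V)) \<mu>"
      "linearly_convergent (matrix (gap_operator \<alpha> \<alpha>\<^sub>1 \<alpha>\<^sub>2 V U)) \<mu>"
      using conv[rule_format, of U V \<mu>] conv[rule_format, of V U \<mu>] that
        friedrichs_angle_UV friedrichs_angle_commute[of U V \<theta>\<^sub>F]
      unfolding dim_U dim_V by auto
  qed
  then show ?opt using gap_parameters_optimal[OF assms(3-5)] by blast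
qed

end
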